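(* Let $(\mathbf{A},\Box,\Diamond)$ be any finite Dunn GAO. Then $$(\mathbf{A},\Box,\Diamond)\cong(\mathbf{G}(\mathbf{F}_{\mathbf{A}}),\beta,\delta)\cong(\mathbf{G}(\mathbf{F}_{\mathbf{A}}),\beta_{R_{\mathbf{A}}},\delta_{R_{\mathbf{A}}})$$ via the same isomorphism $r:A\to G(\mathbf{F}_{\mathbf{A}})$, $r(a)=\{f\in F_{\mathbf{A}}\mid a\in f\}$. In particular, for all $a\in A$, $$r(\Box a)=\beta(r(a))=\beta_{R_{\mathbf{A}}}(r(a))\quad\text{and}\quad r(\Diamond a)=\delta(r(a))=\delta_{R_{\mathbf{A}}}(r(a)).$$
   Context: A G\"odel algebra is a Heyting algebra $\mathbf{A}=(A,\wedge,\vee,\to,\bot,\top)$ satisfying prelinearity $(a\to b)\vee(b\to a)=\top$. A GAO (G\"odel algebra with operators) is a triple $(\mathbf{A},\Box,\Diamond)$ with $\mathbf{A}$ a G\"odel algebra and $\Box,\Diamond:A\to A$ satisfying $\Box\top=\top$, $\Box(x\wedge y)=\Box x\wedge\Box y$, $\Diamond\bot=\bot$, $\Diamond(x\vee y)=\Diamond x\vee\Diamond y$. A Dunn GAO is a GAO satisfying, for all $a,b$: $\Box(a\vee b)\leq\Box a\vee\Diamond b$ and $\Box a\wedge\Diamond b\leq\Diamond(a\wedge b)$. A forest is a finite poset in which the downset of each element is totally ordered. For a finite G\"odel algebra $\mathbf{A}$, $F_{\mathbf{A}}$ is the set of its prime (proper) filters, ordered by $f_1\leq f_2$ iff $f_1\supseteq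 f_2$; $\mathbf{F}_{\mathbf{A}}=(F_{\mathbf{A}},\leq)$ is a finite forest. For a finite forest $\mathbf{F}=(F,\leq)$, $G(\mathbf{F})$ is the set of all downward closed subsets of $F$, and $\mathbf{G}(\mathbf{F})=(G(\mathbf{F}),\cap,\cup,\to,\emptyset,F)$ with $x\to y=F\setminus{\uparrow}(x\setminus y)$, which is a G\"odel algebra. On $F_{\mathbf{A}}$ define: $f_1R_\Box f_2$ iff $\Box^{-1}(f_1)\subseteq f_2$; $f_1R_\Diamond f_2$ iff $f_2\subseteq\Diamond^{-1}(f_1)$; and $R_{\mathbf{A}}=R_\Box\cap R_\Diamond$. For $a\in G(\mathbf{F}_{\mathbf{A}})$ and a relation $S$ on $F_{\mathbf{A}}$ let $\beta_S(a)=\{y\in F_{\mathbf{A}}\mid\forall z\in F_{\mathbf{A}},\ (ySz\Rightarrow z\in a)\}$ and $\delta_S(a)=\{y\in F_{\mathbf{A}}\mid\exists z\in a,\ ySz\}$. Put $\beta=\beta_{R_\Box}$ and $\delta=\delta_{R_\Diamond}$. *)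

theory Defs
  imports "HOL-Algebra.Order"
begin

section \<open>Goedel algebras with operators\<close>

record 'a heyting = "'a partial_object" +
  hmeet :: "'a \<Rightarrow> 'a \<Rightarrow> 'a" (infixl \<open>\<curlywedge>\<index>\<close> 70)
  hjoin :: "'a \<Rightarrow> 'a \<Rightarrow> 'a" (infixl \<open>\<curlyvee>\<index>\<close> 65)
  himp :: "'a \<Rightarrow> 'a \<Rightarrow> 'a" (infixr \<open>\<rightharpoonup>\<index>\<close> 60)
  hbot :: 'a (\<open>\<^bold>\<bottom>\<index>\<close>)
  htop :: 'a (\<open>\<^bold>\<top>\<index>\<close>)

definition hle :: "('a, 'm) heyting_scheme \<Rightarrow> 'a \<Rightarrow> 'a \<Rightarrow> bool" (infix \<open>\<preceq>\<index>\<close> 50)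
  where "a \<preceq>\<^bsub>A\<^esub> b \<longleftrightarrow> a \<curlywedge>\<^bsub>A\<^esub> b = a"

text \<open>The degenerate one-element algebra is allowed: \<open>\<^bold>\<bottom> = \<^bold>\<top>\<close> is not excluded.\<close>

locale heyting_algebra =
  fixes A :: "'a heyting" (structure)
  assumes meet_closed: "\<lbrakk>a \<in> carrier A; b \<in> carrier A\<rbrakk> \<Longrightarrow> a \<curlywedge> b \<in> carrier A"
    and join_closed: "\<lbrakk>a \<in> carrier A; b \<in> carrier A\<rbrakk> \<Longrightarrow> a \<curlyvee> b \<in> carrier A"
    and imp_closed: "\<lbrakk>a \<in> carrier A; b \<in> carrier A\<rbrakk> \<Longrightarrow> a \<rightharpoonup> b \<in> carrier A"
    and bot_closed: "\<^bold>\<bottom> \<in> carrier A"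
    and top_closed: "\<^bold>\<top> \<in> carrier A"
    and meet_assoc: "\<lbrakk>a \<in> carrier A; b \<in> carrier A; c \<in> carrier A\<rbrakk>
          \<Longrightarrow> (a \<curlywedge> b) \<curlywedge> c = a \<curlywedge> (b \<curlywedge> c)"
    and join_assoc: "\<lbrakk>a \<in> carrier A; b \<in> carrier A; c \<in> carrier A\<rbrakk>
          \<Longrightarrow> (a \<curlyvee> b) \<curlyvee> c = a \<curlyvee> (b \<curlyvee> c)"
    and meet_comm: "\<lbrakk>a \<in> carrier A; b \<in> carrier A\<rbrakk> \<Longrightarrow> a \<curlywedge> b = b \<curlywedge> a"
    and join_comm: "\<lbrakk>a \<in> carrier A; b \<in> carrier A\<rbrakk> \<Longrightarrow> a \<curlyvee> b = b \<curlyvee> a"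
    and meet_absorb: "\<lbrakk>a \<in> carrier A; b \<in> carrier A\<rbrakk> \<Longrightarrow> a \<curlywedge> (a \<curlyvee> b) = a"
    and join_absorb: "\<lbrakk>a \<in> carrier A; b \<in> carrier A\<rbrakk> \<Longrightarrow> a \<curlyvee> (a \<curlywedge> b) = a"
    and bot_least: "a \<in> carrier A \<Longrightarrow> \<^bold>\<bottom> \<preceq> a"
    and top_greatest: "a \<in> carrier A \<Longrightarrow> a \<preceq> \<^bold>\<top>"
    and residuation: "\<lbrakk>a \<in> carrier A; b \<in> carrier A; c \<in> carrier A\<rbrakk>
          \<Longrightarrow> a \<curlywedge> b \<preceq> c \<longleftrightarrow> a \<preceq> b \<rightharpoonup> c"

locale godel_algebra = heyting_algebra +
  assumes prelinearity: "\<lbrakk>a \<in> carrier A; b \<in> carrier A\<rbrakk> \<Longrightarrow> (a \<rightharpoonup> b) \<curlyvee> (b \<rightharpoonup> a) = \<^bold>\<top>"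

locale gao = godel_algebra A for A :: "'a heyting" (structure) +
  fixes box :: "'a \<Rightarrow> 'a" and dia :: "'a \<Rightarrow> 'a"
  assumes box_closed: "a \<in> carrier A \<Longrightarrow> box a \<in> carrier A"
    and dia_closed: "a \<in> carrier A \<Longrightarrow> dia a \<in> carrier A"
    and box_top: "box \<^bold>\<top> = \<^bold>\<top>"
    and box_meet: "\<lbrakk>a \<in> carrier A; b \<in> carrier A\<rbrakk> \<Longrightarrow> box (a \<curlywedge> b) = box a \<curlywedge> box b"
    and dia_bot: "dia \<^bold>\<bottom> = \<^bold>\<bottom>"
    and dia_join: "\<lbrakk>a \<in> carrier A; b \<in> carrier A\<rbrakk> \<Longrightarrow> dia (a \<curlyvee> b) = dia a \<curlyvee> dia b"

locale dunn_gao = gao +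
  assumes dunn_box: "\<lbrakk>a \<in> carrier A; b \<in> carrier A\<rbrakk> \<Longrightarrow> box (a \<curlyvee> b) \<preceq> box a \<curlyvee> dia b"
    and dunn_dia: "\<lbrakk>a \<in> carrier A; b \<in> carrier A\<rbrakk> \<Longrightarrow> box a \<curlywedge> dia b \<preceq> dia (a \<curlywedge> b)"

definition heyting_iso :: "'a heyting \<Rightarrow> 'b heyting \<Rightarrow> ('a \<Rightarrow> 'b) set"
  where "heyting_iso A B = {h. bij_betw h (carrier A) (carrier B) \<and>
    (\<forall>a\<in>carrier A. \<forall>b\<in>carrier A.
       h (a \<curlywedge>\<^bsub>A\<^esub> b) = h a \<curlywedge>\<^bsub>B\<^esub> h b \<and>
       h (a \<curlyvee>\<^bsub>A\<^esub> b) = h a \<curlyvee>\<^bsub>B\<^esub> h b \<and>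
       h (a \<rightharpoonup>\<^bsub>A\<^esub> b) = h a \<rightharpoonup>\<^bsub>B\<^esub> h b) \<and>
    h \<^bold>\<bottom>\<^bsub>A\<^esub> = \<^bold>\<bottom>\<^bsub>B\<^esub> \<and> h \<^bold>\<top>\<^bsub>A\<^esub> = \<^bold>\<top>\<^bsub>B\<^esub>}"

fun gao_iso ::
  "'a heyting \<times> ('a \<Rightarrow> 'a) \<times> ('a \<Rightarrow> 'a) \<Rightarrow> 'b heyting \<times> ('b \<Rightarrow> 'b) \<times> ('b \<Rightarrow> 'b) \<Rightarrow> ('a \<Rightarrow> 'b) set"
  where "gao_iso (A, box, dia) (B, box', dia') = {h \<in> heyting_iso A B.
    \<forall>a\<in>carrier A. h (box a) = box' (h a) \<and> h (dia a) = dia' (h a)}"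

definition gao_isomorphic ::
  "'a heyting \<times> ('a \<Rightarrow> 'a) \<times> ('a \<Rightarrow> 'a) \<Rightarrow> 'b heyting \<times> ('b \<Rightarrow> 'b) \<times> ('b \<Rightarrow> 'b) \<Rightarrow> bool"
  (infix \<open>\<cong>\<^sub>G\<close> 50)
  where "X \<cong>\<^sub>G Y \<longleftrightarrow> gao_iso X Y \<noteq> {}"


section \<open>Forests\<close>

locale finite_forest = partial_order F for F :: "'b gorder" (structure) +
  assumes finite_carrier: "finite (carrier F)"
    and downset_total: "\<lbrakk>x \<in> carrier F; y \<in> carrier F; z \<in> carrier F; y \<sqsubseteq> x; z \<sqsubseteq> x\<rbrakk>
          \<Longrightarrow> y \<sqsubseteq> z \<or> z \<sqsubseteq> y"

definition downsets :: "'b gorder \<Rightarrow> 'b set set"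
  where "downsets F =
    {x. x \<subseteq> carrier F \<and> (\<forall>v\<in>x. \<forall>u\<in>carrier F. u \<sqsubseteq>\<^bsub>F\<^esub> v \<longrightarrow> u \<in> x)}"

definition up_closure :: "'b gorder \<Rightarrow> 'b set \<Rightarrow> 'b set"
  where "up_closure F x = {v \<in> carrier F. \<exists>u\<in>x. u \<sqsubseteq>\<^bsub>F\<^esub> v}"

definition forest_algebra :: "'b gorder \<Rightarrow> 'b set heyting" (\<open>\<G>\<close>)
  where "\<G> F = \<lparr>carrier = downsets F, hmeet = (\<inter>), hjoin = (\<union>),
    himp = (\<lambda>x y. carrier F - up_closure F (x - y)), hbot = {}, htop = carrier F\<rparr>"


section \<open>Prime filters and the canonical relations\<close>

definition prime_filters :: "'a heyting \<Rightarrow> 'a set set"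
  where "prime_filters A = {f. f \<subseteq> carrier A \<and> f \<noteq> {} \<and> f \<noteq> carrier A \<and>
    (\<forall>a\<in>f. \<forall>b\<in>carrier A. a \<preceq>\<^bsub>A\<^esub> b \<longrightarrow> b \<in> f) \<and>
    (\<forall>a\<in>f. \<forall>b\<in>f. a \<curlywedge>\<^bsub>A\<^esub> b \<in> f) \<and>
    (\<forall>a\<in>carrier A. \<forall>b\<in>carrier A. a \<curlyvee>\<^bsub>A\<^esub> b \<in> f \<longrightarrow> a \<in> f \<or> b \<in> f)}"

text \<open>The order is reverse inclusion.\<close>

definition prime_forest :: "'a heyting \<Rightarrow> 'a set gorder" (\<open>\<F>\<close>)
  where "\<F> A = \<lparr>carrier = prime_filters A, eq = (=), le = (\<lambda>f1 f2. f1 \<supseteq> f2)\<rparr>"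

definition R_box :: "'a heyting \<Rightarrow> ('a \<Rightarrow> 'a) \<Rightarrow> ('a set \<times> 'a set) set"
  where "R_box A box = {(f1, f2). f1 \<in> prime_filters A \<and> f2 \<in> prime_filters A \<and>
    {a \<in> carrier A. box a \<in> f1} \<subseteq> f2}"

definition R_dia :: "'a heyting \<Rightarrow> ('a \<Rightarrow> 'a) \<Rightarrow> ('a set \<times> 'a set) set"
  where "R_dia A dia = {(f1, f2). f1 \<in> prime_filters A \<and> f2 \<in> prime_filters A \<and>
    f2 \<subseteq> {a \<in> carrier A. dia a \<in> f1}}"

definition R_both :: "'a heyting \<Rightarrow> ('a \<Rightarrow> 'a) \<Rightarrow> ('a \<Rightarrow> 'a) \<Rightarrow> ('a set \<times> 'a set) set"
  where "R_both A box dia = R_box A box \<inter> R_dia A dia"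

definition beta :: "'a heyting \<Rightarrow> ('a set \<times> 'a set) set \<Rightarrow> 'a set set \<Rightarrow> 'a set set"
  where "beta A S x =
    {y \<in> prime_filters A. \<forall>z\<in>prime_filters A. (y, z) \<in> S \<longrightarrow> z \<in> x}"

definition delta :: "'a heyting \<Rightarrow> ('a set \<times> 'a set) set \<Rightarrow> 'a set set \<Rightarrow> 'a set set"
  where "delta A S x = {y \<in> prime_filters A. \<exists>z\<in>x. (y, z) \<in> S}"

definition rmap :: "'a heyting \<Rightarrow> 'a \<Rightarrow> 'a set set"
  where "rmap A a = {f \<in> prime_filters A. a \<in> f}"


section \<open>The constructions are well defined\<close>

lemma (in finite_forest) godel_algebra_forest_algebra: "godel_algebra (\<G> F)"
proof -
  have res: "(x \<inter> y \<subseteq> z) = (x \<subseteq> carrier F - up_closure F (y - z))"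
    if "x \<in> downsets F" "y \<in> downsets F" "z \<in> downsets F" for x y z
  proof
    assume "x \<inter> y \<subseteq> z"
    with that show "x \<subseteq> carrier F - up_closure F (y - z)"
      unfolding downsets_def up_closure_def by blast
  next
    assume *: "x \<subseteq> carrier F - up_closure F (y - z)"
    show "x \<inter> y \<subseteq> z"
    proof
      fix u assume u: "u \<in> x \<inter> y"
      with that have "u \<in> carrier F" by (auto simp: downsets_def)
      moreover from this have "u \<sqsubseteq> u" by simp
      ultimately show "u \<in> z" using u * by (auto simp: up_closure_def)
    qed
  qed
  have imp: "carrier F - up_closure F (x - y) \<in> downsets F"
    if "x \<in> downsets F" "y \<in> downsets F" for x y
    unfolding downsets_def up_closure_def
  proof (safe, goal_cases)
    case (1 v u w)
    with that have "w \<in> carrier F" by (auto simp: downsets_def)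
    with 1 show ?case using le_trans by blast
  qed
  have pre: "(carrier F - up_closure F (x - y)) \<union> (carrier F - up_closure F (y - x)) = carrier F"
    if "x \<in> downsets F" "y \<in> downsets F" for x y
  proof -
    have "False" if v: "v \<in> up_closure F (x - y)" "v \<in> up_closure F (y - x)" for v
    proof -
      from v obtain u w where uw: "v \<in> carrier F" "u \<in> x - y" "u \<sqsubseteq> v" "w \<in> y - x" "w \<sqsubseteq> v"
        by (auto simp: up_closure_def)
      with \<open>x \<in> downsets F\<close> \<open>y \<in> downsets F\<close> have c: "u \<in> carrier F" "w \<in> carrier F"
        by (auto simp: downsets_def)
      with uw downset_total have "u \<sqsubseteq> w \<or> w \<sqsubseteq> u" by blast
      with uw c \<open>x \<in> downsets F\<close> \<open>y \<in> downsets F\<close> show False by (auto simp: downsets_def)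
    qed
    then show ?thesis by blast
  qed
  have le: "x \<preceq>\<^bsub>\<G> F\<^esub> y \<longleftrightarrow> x \<subseteq> y" for x y
    by (auto simp: hle_def forest_algebra_def)
  have bin: "x \<inter> y \<in> downsets F" "x \<union> y \<in> downsets F"
    if "x \<in> downsets F" "y \<in> downsets F" for x y
    using that by (auto simp: downsets_def)
  have bnd: "{} \<in> downsets F" "carrier F \<in> downsets F"
    "x \<in> downsets F \<Longrightarrow> x \<subseteq> carrier F" for x
    by (auto simp: downsets_def)
  show ?thesis
  proof (unfold_locales, unfold le, goal_cases)
    case (14 x y z)
    then show ?case using res by (simp add: forest_algebra_def)
  qed (auto simp: forest_algebra_def imp pre bin bnd dest: bnd(3))
qed

lemma (in godel_algebra) finite_forest_prime_forest:
  assumes "finite (carrier A)"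
  shows "finite_forest (\<F> A)"
proof -
  have tot: "g \<subseteq> h \<or> h \<subseteq> g"
    if f: "f \<in> prime_filters A" and g: "g \<in> prime_filters A" and h: "h \<in> prime_filters A"
      and sub: "f \<subseteq> g" "f \<subseteq> h" for f g h
  proof (rule ccontr)
    assume "\<not> ?thesis"
    then obtain x y where xy: "x \<in> g" "x \<notin> h" "y \<in> h" "y \<notin> g" by blast
    then have c: "x \<in> carrier A" "y \<in> carrier A"
      using g h by (auto simp: prime_filters_def)
    have mp: "b \<in> k" if "k \<in> prime_filters A" "a \<in> k" "a \<rightharpoonup> b \<in> k" "b \<in> carrier A" for a b k
    proof -
      have cc: "a \<in> carrier A" "a \<rightharpoonup> b \<in> carrier A" using that by (auto simp: prime_filters_def)
      then have "(a \<rightharpoonup> b) \<preceq> (a \<rightharpoonup> b)"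
        by (metis hle_def join_absorb meet_absorb meet_closed)
      then have "(a \<rightharpoonup> b) \<curlywedge> a \<preceq> b" using cc that residuation by blast
      then show ?thesis using that by (auto simp: prime_filters_def)
    qed
    from f obtain e where "e \<in> f" "e \<in> carrier A" by (auto simp: prime_filters_def)
    then have "\<^bold>\<top> \<in> f" using f top_closed top_greatest by (auto simp: prime_filters_def)
    then have "x \<rightharpoonup> y \<in> f \<or> y \<rightharpoonup> x \<in> f"
      using f prelinearity[OF c] imp_closed[OF c] imp_closed[OF c(2,1)] unfolding prime_filters_def
      by (metis (mono_tags, lifting) mem_Collect_eq)
    then show False using mp g h xy c sub by blast
  qed
  have "finite (prime_filters A)"
    by (rule finite_subset[of _ "Pow (carrier A)"]) (use assms in \<open>auto simp: prime_filters_def\<close>)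
  then show ?thesis
    by unfold_locales (use tot in \<open>auto simp: prime_forest_def\<close>)
qed

end

theory Submission
  imports Defs
begin

text \<open>Everything rests on separating a meet-closed set from a join-closed set by a prime filter.
  Let \<open>f\<close> be a prime filter, \<open>P = {b. \<box>b \<in> f}\<close> and \<open>N = {n. \<diamond>n \<notin> f}\<close>. The first Dunn axiom says that
  \<open>P\<close> can be separated from \<open>{a \<or> n | n \<in> N}\<close> whenever \<open>\<box>a \<notin> f\<close>; the second one says that
  \<open>{b \<and> a | b \<in> P}\<close> can be separated from \<open>N\<close> whenever \<open>\<diamond>a \<in> f\<close>. In both cases the separating prime
  filter is a successor of \<open>f\<close> for \<open>R\<^sub>\<box>\<close> and for \<open>R\<^sub>\<diamond>\<close> at the same time, so replacing either relation
  by the intersection does not change the operator.\<close>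

section \<open>Order and prime filters\<close>

context heyting_algebra
begin

lemma le_refl: "a \<in> carrier A \<Longrightarrow> a \<preceq> a"
  by (metis hle_def join_absorb meet_absorb meet_closed)

lemma le_trans:
  assumes "a \<preceq> b" "b \<preceq> c" "a \<in> carrier A" "b \<in> carrier A" "c \<in> carrier A"
  shows "a \<preceq> c"
  using assms unfolding hle_def by (metis meet_assoc)

lemma le_antisym:
  assumes "a \<preceq> b" "b \<preceq> a" "a \<in> carrier A" "b \<in> carrier A"
  shows "a = b"
  using assms unfolding hle_def by (metis meet_comm)

lemma meet_le1: "\<lbrakk>a \<in> carrier A; b \<in> carrier A\<rbrakk> \<Longrightarrow> a \<curlywedge> b \<preceq> a"
  by (metis hle_def le_refl meet_assoc meet_comm)

lemma meet_le2: "\<lbrakk>a \<in> carrier A; b \<in> carrier A\<rbrakk> \<Longrightarrow> a \<curlywedge> b \<preceq> b"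
  by (metis meet_comm meet_le1)

lemma le_meetI:
  assumes "c \<preceq> a" "c \<preceq> b" "a \<in> carrier A" "b \<in> carrier A" "c \<in> carrier A"
  shows "c \<preceq> a \<curlywedge> b"
  using assms unfolding hle_def by (metis meet_assoc)

lemma join_ge1: "\<lbrakk>a \<in> carrier A; b \<in> carrier A\<rbrakk> \<Longrightarrow> a \<preceq> a \<curlyvee> b"
  by (simp add: hle_def meet_absorb)

lemma join_ge2: "\<lbrakk>a \<in> carrier A; b \<in> carrier A\<rbrakk> \<Longrightarrow> b \<preceq> a \<curlyvee> b"
  by (metis join_comm join_ge1)

lemma le_iff_join: "\<lbrakk>a \<in> carrier A; b \<in> carrier A\<rbrakk> \<Longrightarrow> a \<preceq> b \<longleftrightarrow> a \<curlyvee> b = b"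
  unfolding hle_def by (metis join_absorb join_comm meet_absorb meet_comm)

lemma join_leI:
  assumes "a \<preceq> c" "b \<preceq> c" "a \<in> carrier A" "b \<in> carrier A" "c \<in> carrier A"
  shows "a \<curlyvee> b \<preceq> c"
  using assms by (simp add: le_iff_join join_assoc join_closed)

lemma meet_mono:
  assumes "a \<preceq> c" "b \<preceq> d"
    and "a \<in> carrier A" "b \<in> carrier A" "c \<in> carrier A" "d \<in> carrier A"
  shows "a \<curlywedge> b \<preceq> c \<curlywedge> d"
  using assms by (meson le_meetI le_trans meet_closed meet_le1 meet_le2)

text \<open>Distributivity in the only form used below. Both joinands lie below
  \<open>x \<rightharpoonup> c\<close> by residuation, hence so does their join.\<close>

lemma meet_join_leI:
  assumes "x \<curlywedge> a \<preceq> c" "x \<curlywedge> b \<preceq> c"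
    and "x \<in> carrier A" "a \<in> carrier A" "b \<in> carrier A" "c \<in> carrier A"
  shows "x \<curlywedge> (a \<curlyvee> b) \<preceq> c"
proof -
  have "a \<preceq> x \<rightharpoonup> c" "b \<preceq> x \<rightharpoonup> c"
    using assms by (metis meet_comm residuation)+
  then have "a \<curlyvee> b \<preceq> x \<rightharpoonup> c"
    using assms by (simp add: join_leI imp_closed)
  then show ?thesis
    using assms by (metis join_closed meet_comm residuation)
qed

text \<open>Shows that meeting every element of a meet-closed set with a fixed \<open>c\<close>
  gives a meet-closed set again. The next lemma is the dual fact for joins.\<close>

lemma meet_meet_distrib_right:
  assumes "a \<in> carrier A" "b \<in> carrier A" "c \<in> carrier A"
  shows "(a \<curlywedge> c) \<curlywedge> (b \<curlywedge> c) = (a \<curlywedge> b) \<curlywedge> c"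
proof -
  have "(a \<curlywedge> c) \<curlywedge> (b \<curlywedge> c) = a \<curlywedge> ((b \<curlywedge> c) \<curlywedge> c)"
    using assms by (metis meet_assoc meet_closed meet_comm)
  also have "(b \<curlywedge> c) \<curlywedge> c = b \<curlywedge> c"
    using assms meet_le2 by (simp add: hle_def)
  finally show ?thesis using assms by (simp add: meet_assoc)
qed

lemma join_join_distrib_left:
  assumes "a \<in> carrier A" "b \<in> carrier A" "c \<in> carrier A"
  shows "(a \<curlyvee> b) \<curlyvee> (a \<curlyvee> c) = a \<curlyvee> (b \<curlyvee> c)"
proof -
  have "(a \<curlyvee> b) \<curlyvee> (a \<curlyvee> c) = (a \<curlyvee> (a \<curlyvee> b)) \<curlyvee> c"
    using assms by (metis join_assoc join_closed join_comm)
  also have "a \<curlyvee> (a \<curlyvee> b) = a \<curlyvee> b"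
    using assms join_ge1 by (simp add: le_iff_join[symmetric] join_closed)
  finally show ?thesis using assms by (simp add: join_assoc)
qed

section \<open>Prime filters and their separation theorem\<close>

lemma prime_filter_subset: "f \<in> prime_filters A \<Longrightarrow> f \<subseteq> carrier A"
  by (simp add: prime_filters_def)

lemma prime_filter_le:
  "\<lbrakk>f \<in> prime_filters A; a \<in> f; a \<preceq> b; b \<in> carrier A\<rbrakk> \<Longrightarrow> b \<in> f"
  by (auto simp: prime_filters_def)

lemma prime_filter_meet_iff:
  assumes "f \<in> prime_filters A" "a \<in> carrier A" "b \<in> carrier A"
  shows "a \<curlywedge> b \<in> f \<longleftrightarrow> a \<in> f \<and> b \<in> f"
proof
  assume "a \<curlywedge> b \<in> f"
  with assms show "a \<in> f \<and> b \<in> f"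
    by (blast intro: prime_filter_le meet_le1 meet_le2)
qed (use assms in \<open>simp add: prime_filters_def\<close>)

lemma prime_filter_join_iff:
  assumes "f \<in> prime_filters A" "a \<in> carrier A" "b \<in> carrier A"
  shows "a \<curlyvee> b \<in> f \<longleftrightarrow> a \<in> f \<or> b \<in> f"
proof
  assume "a \<in> f \<or> b \<in> f"
  with assms show "a \<curlyvee> b \<in> f"
    by (blast intro: prime_filter_le join_ge1 join_ge2 join_closed)
qed (use assms in \<open>simp add: prime_filters_def\<close>)

lemma prime_filter_top:
  assumes f: "f \<in> prime_filters A"
  shows "\<^bold>\<top> \<in> f"
proof -
  obtain e where "e \<in> f" using f unfolding prime_filters_def by blast
  moreover from this have "e \<preceq> \<^bold>\<top>" using prime_filter_subset[OF f] top_greatest by blast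
  ultimately show ?thesis using prime_filter_le[OF f] top_closed by blast
qed

lemma prime_filter_bot:
  assumes "f \<in> prime_filters A"
  shows "\<^bold>\<bottom> \<notin> f"
proof
  assume "\<^bold>\<bottom> \<in> f"
  then have "carrier A \<subseteq> f"
    using assms bot_least prime_filter_le by blast
  with assms show False by (auto simp: prime_filters_def)
qed

theorem prime_filter_separation:
  assumes P: "P \<subseteq> carrier A" "P \<noteq> {}" "\<And>x y. \<lbrakk>x \<in> P; y \<in> P\<rbrakk> \<Longrightarrow> x \<curlywedge> y \<in> P"
    and N: "N \<subseteq> carrier A" "N \<noteq> {}" "\<And>x y. \<lbrakk>x \<in> N; y \<in> N\<rbrakk> \<Longrightarrow> x \<curlyvee> y \<in> N"
    and sep: "\<And>x y. \<lbrakk>x \<in> P; y \<in> N\<rbrakk> \<Longrightarrow> \<not> x \<preceq> y"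
  obtains g where "g \<in> prime_filters A" "P \<subseteq> g" "g \<inter> N = {}"
proof -
  define C where "C = {g. P \<subseteq> g \<and> g \<subseteq> carrier A \<and> (\<forall>x\<in>g. \<forall>y\<in>g. x \<curlywedge> y \<in> g) \<and>
    (\<forall>x\<in>g. \<forall>y\<in>N. \<not> x \<preceq> y)}"
  have "\<exists>g\<in>C. \<forall>h\<in>C. g \<subseteq> h \<longrightarrow> h = g"
  proof (rule subset_Zorn_nonempty)
    have "P \<in> C" unfolding C_def using P(1,3) sep by simp
    then show "C \<noteq> {}" by blast
  next
    fix K assume K: "K \<noteq> {}" "subset.chain C K"
    then have KC: "K \<subseteq> C" by (simp add: subset.chain_def)
    have "x \<curlywedge> y \<in> \<Union>K" if "x \<in> \<Union>K" "y \<in> \<Union>K" for x y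
    proof -
      from that obtain g h where gh: "x \<in> g" "g \<in> K" "y \<in> h" "h \<in> K" by blast
      then have "g \<subseteq> h \<or> h \<subseteq> g" using K by (auto simp: subset_chain_def)
      then obtain k where "k \<in> K" "x \<in> k" "y \<in> k" using gh by blast
      then show ?thesis using KC by (auto simp: C_def)
    qed
    moreover have "P \<subseteq> \<Union>K" "\<Union>K \<subseteq> carrier A" "\<forall>x\<in>\<Union>K. \<forall>y\<in>N. \<not> x \<preceq> y"
      using K(1) KC unfolding C_def by blast+
    ultimately show "\<Union>K \<in> C" unfolding C_def by blast
  qed
  then obtain g where g: "g \<in> C" and max: "\<And>h. \<lbrakk>h \<in> C; g \<subseteq> h\<rbrakk> \<Longrightarrow> h = g" by blast
  have gA: "x \<in> carrier A" if "x \<in> g" for x using g that by (auto simp: C_def)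
  have NA: "x \<in> carrier A" if "x \<in> N" for x using N that by auto
  have gmeet: "x \<curlywedge> y \<in> g" if "x \<in> g" "y \<in> g" for x y using g that by (simp add: C_def)
  have gN: "\<not> x \<preceq> y" if "x \<in> g" "y \<in> N" for x y using g that by (simp add: C_def)
  have Pg: "P \<subseteq> g" using g by (simp add: C_def)
  obtain e where e: "e \<in> g" using Pg P(2) by blast
  obtain n where n: "n \<in> N" using N(2) by blast
  \<comment> \<open>Maximality in usable form: adjoining a new \<open>a\<close> to \<open>g\<close>
    must violate separation from \<open>N\<close>.\<close>
  have ext: "\<exists>x\<in>g. \<exists>i\<in>N. x \<curlywedge> a \<preceq> i" if a: "a \<in> carrier A" "a \<notin> g" for a
  proof (rule ccontr)
    assume no: "\<not> ?thesis"
    \<comment> \<open>The filter generated by \<open>g\<close> and \<open>a\<close>; if no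
      \<open>x \<curlywedge> a\<close> were below \<open>N\<close>, it would be a strictly larger
      member of \<open>C\<close>.\<close>
    define h where "h = {z \<in> carrier A. \<exists>x\<in>g. x \<curlywedge> a \<preceq> z}"
    have gh: "g \<subseteq> h" using a gA by (auto simp: h_def intro: meet_le1)
    have "x \<curlywedge> y \<in> h" if "x \<in> h" "y \<in> h" for x y
    proof -
      from that obtain u v where uv: "u \<in> g" "v \<in> g" "u \<curlywedge> a \<preceq> x" "v \<curlywedge> a \<preceq> y"
        and xy: "x \<in> carrier A" "y \<in> carrier A" by (auto simp: h_def)
      have "(u \<curlywedge> v) \<curlywedge> a \<preceq> u \<curlywedge> a" "(u \<curlywedge> v) \<curlywedge> a \<preceq> v \<curlywedge> a"
        using uv gA a by (simp_all add: meet_mono meet_closed meet_le1 meet_le2 le_refl)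
      then have "(u \<curlywedge> v) \<curlywedge> a \<preceq> x" "(u \<curlywedge> v) \<curlywedge> a \<preceq> y"
        using uv xy gA a by (meson le_trans meet_closed)+
      then have "(u \<curlywedge> v) \<curlywedge> a \<preceq> x \<curlywedge> y"
        using uv xy gA a by (simp add: le_meetI meet_closed)
      then show ?thesis using uv xy gmeet meet_closed by (auto simp: h_def)
    qed
    moreover have "\<not> x \<preceq> y" if "x \<in> h" "y \<in> N" for x y
    proof
      assume "x \<preceq> y"
      moreover from that(1) obtain u where "u \<in> g" "u \<curlywedge> a \<preceq> x" "x \<in> carrier A"
        by (auto simp: h_def)
      ultimately have "u \<curlywedge> a \<preceq> y"
        using le_trans[of "u \<curlywedge> a" x y] a gA NA that(2) meet_closed by blast
      with no \<open>u \<in> g\<close> that(2) show False by blast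
    qed
    moreover have "h \<subseteq> carrier A" by (auto simp: h_def)
    ultimately have "h \<in> C" using Pg gh unfolding C_def by simp
    then have "h = g" using max gh by blast
    moreover have "a \<in> h" using e gA a meet_le2 by (auto simp: h_def)
    ultimately show False using a by simp
  qed
  have "b \<in> g" if "a \<in> g" "a \<preceq> b" "b \<in> carrier A" for a b
  proof (rule ccontr)
    assume "b \<notin> g"
    then obtain x i where xi: "x \<in> g" "i \<in> N" "x \<curlywedge> b \<preceq> i" using ext \<open>b \<in> carrier A\<close> by blast
    have "x \<curlywedge> a \<preceq> x \<curlywedge> b" using xi that gA by (simp add: meet_mono le_refl)
    then have "x \<curlywedge> a \<preceq> i" using xi that gA NA by (meson le_trans meet_closed)
    then show False using gN gmeet xi that by blast
  qed
  moreover have "a \<in> g \<or> b \<in> g"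
    if ab: "a \<curlyvee> b \<in> g" "a \<in> carrier A" "b \<in> carrier A" for a b
  proof (rule ccontr)
    assume "\<not> ?thesis"
    \<comment> \<open>The element \<open>x \<curlywedge> y\<close> of \<open>g\<close> serves both
      joinands, and \<open>i \<curlyvee> j\<close> in \<open>N\<close> bounds both results.
      Distributivity then puts \<open>(x \<curlywedge> y) \<curlywedge> (a \<curlyvee> b)\<close>,
      an element of \<open>g\<close>, below \<open>N\<close>.\<close>
    with ext ab obtain x i y j where x: "x \<in> g" "i \<in> N" "x \<curlywedge> a \<preceq> i"
      and y: "y \<in> g" "j \<in> N" "y \<curlywedge> b \<preceq> j" by metis
    note c = gA[OF x(1)] gA[OF y(1)] NA[OF x(2)] NA[OF y(2)] ab(2,3)
    have "(x \<curlywedge> y) \<curlywedge> a \<preceq> x \<curlywedge> a" "(x \<curlywedge> y) \<curlywedge> b \<preceq> y \<curlywedge> b"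
      using c by (simp_all add: meet_mono meet_closed meet_le1 meet_le2 le_refl)
    moreover have "i \<preceq> i \<curlyvee> j" "j \<preceq> i \<curlyvee> j" using c by (simp_all add: join_ge1 join_ge2)
    ultimately have "(x \<curlywedge> y) \<curlywedge> a \<preceq> i \<curlyvee> j" "(x \<curlywedge> y) \<curlywedge> b \<preceq> i \<curlyvee> j"
      using x(3) y(3) c by (meson le_trans meet_closed join_closed)+
    then have "(x \<curlywedge> y) \<curlywedge> (a \<curlyvee> b) \<preceq> i \<curlyvee> j"
      using c by (simp add: meet_join_leI meet_closed join_closed)
    with gN[OF gmeet[OF gmeet[OF x(1) y(1)] ab(1)] N(3)[OF x(2) y(2)]] show False by blast
  qed
  \<comment> \<open>A single element of \<open>N\<close> outside \<open>g\<close> makes the filter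
    proper.\<close>
  moreover have "n \<notin> g" using gN n NA le_refl by blast
  moreover have "g \<subseteq> carrier A" "g \<noteq> {}" using gA e by auto
  ultimately have "g \<in> prime_filters A"
    using NA[OF n] gmeet unfolding prime_filters_def by simp blast
  moreover have "g \<inter> N = {}" using gN NA le_refl by blast
  ultimately show thesis using that Pg by blast
qed

section \<open>The representation map\<close>

lemma rmap_downset: "rmap A a \<in> downsets (\<F> A)"
  by (auto simp: rmap_def downsets_def prime_forest_def)

lemma rmap_meet:
  "\<lbrakk>a \<in> carrier A; b \<in> carrier A\<rbrakk> \<Longrightarrow> rmap A (a \<curlywedge> b) = rmap A a \<inter> rmap A b"
  by (auto simp: rmap_def prime_filter_meet_iff)

lemma rmap_join:
  "\<lbrakk>a \<in> carrier A; b \<in> carrier A\<rbrakk> \<Longrightarrow> rmap A (a \<curlyvee> b) = rmap A a \<union> rmap A b"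
  by (auto simp: rmap_def prime_filter_join_iff)

lemma rmap_bot: "rmap A \<^bold>\<bottom> = {}"
  by (auto simp: rmap_def prime_filter_bot)

lemma rmap_top: "rmap A \<^bold>\<top> = prime_filters A"
  by (auto simp: rmap_def prime_filter_top)

text \<open>This is the Kripke clause for implication: \<open>a \<rightharpoonup> b\<close> belongs
  to \<open>f\<close> iff every prime filter above \<open>f\<close> under inclusion that contains
  \<open>a\<close> also contains \<open>b\<close>. Inclusion appears reversed in the order of the
  forest, so \<open>up_closure\<close> collects exactly the \<open>f\<close> that have a
  counterexample \<open>g\<close>.\<close>

lemma rmap_imp:
  assumes a: "a \<in> carrier A" and b: "b \<in> carrier A"
  shows "rmap A (a \<rightharpoonup> b) = prime_filters A - up_closure (\<F> A) (rmap A a - rmap A b)"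
proof -
  have "a \<rightharpoonup> b \<in> f \<longleftrightarrow> (\<forall>g\<in>prime_filters A. f \<subseteq> g \<longrightarrow> a \<in> g \<longrightarrow> b \<in> g)"
    if f: "f \<in> prime_filters A" for f
  proof (intro iffI ballI impI)
    fix g assume "a \<rightharpoonup> b \<in> f" "g \<in> prime_filters A" "f \<subseteq> g" "a \<in> g"
    then have "(a \<rightharpoonup> b) \<curlywedge> a \<in> g" using a b by (auto simp: prime_filter_meet_iff imp_closed)
    moreover have "(a \<rightharpoonup> b) \<curlywedge> a \<preceq> b" using a b by (simp add: residuation imp_closed le_refl)
    ultimately show "b \<in> g" using \<open>g \<in> prime_filters A\<close> b prime_filter_le by blast
  next
    assume all: "\<forall>g\<in>prime_filters A. f \<subseteq> g \<longrightarrow> a \<in> g \<longrightarrow> b \<in> g"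
    note fA = subsetD[OF prime_filter_subset[OF f]]
    show "a \<rightharpoonup> b \<in> f"
    proof (rule ccontr)
      assume nin: "a \<rightharpoonup> b \<notin> f"
      \<comment> \<open>A prime filter that includes this set contains \<open>f\<close> and
        \<open>a\<close>. It can be kept away from \<open>b\<close>, since
        \<open>u \<curlywedge> a \<preceq> b\<close> with \<open>u\<close> in \<open>f\<close> would
        put \<open>a \<rightharpoonup> b\<close> in \<open>f\<close>.\<close>
      let ?P = "(\<lambda>x. x \<curlywedge> a) ` f"
      obtain g where g: "g \<in> prime_filters A" "?P \<subseteq> g" "g \<inter> {b} = {}"
      proof (rule prime_filter_separation[of ?P "{b}"])
        show "?P \<subseteq> carrier A" using fA a meet_closed by auto
        show "?P \<noteq> {}" using prime_filter_top[OF f] by blast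
        show "x \<curlywedge> y \<in> ?P" if "x \<in> ?P" "y \<in> ?P" for x y
        proof -
          from that obtain u v where uv: "u \<in> f" "v \<in> f" "x = u \<curlywedge> a" "y = v \<curlywedge> a" by blast
          then have "x \<curlywedge> y = (u \<curlywedge> v) \<curlywedge> a"
            using fA a by (simp add: meet_meet_distrib_right)
          then show ?thesis using uv f fA prime_filter_meet_iff by blast
        qed
        show "\<not> x \<preceq> y" if "x \<in> ?P" "y \<in> {b}" for x y
        proof
          assume "x \<preceq> y"
          with that obtain u where u: "u \<in> f" "u \<curlywedge> a \<preceq> b" by blast
          then have "u \<preceq> a \<rightharpoonup> b" using residuation fA a b by blast
          then show False using nin u f prime_filter_le imp_closed a b by blast
        qed
        show "x \<curlyvee> y \<in> {b}" if "x \<in> {b}" "y \<in> {b}" for x y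
          using that b by (auto simp: le_iff_join[symmetric] le_refl)
      qed (use b in auto)
      have "x \<in> g \<and> a \<in> g" if "x \<in> f" for x
        using g that fA a prime_filter_meet_iff by blast
      then show False using all g prime_filter_top[OF f] by blast
    qed
  qed
  then show ?thesis
    by (auto simp: rmap_def up_closure_def prime_forest_def)
qed

text \<open>If \<open>a \<preceq> b\<close> fails, the singletons of \<open>a\<close> and
  \<open>b\<close> are separated by a prime filter; by idempotence they are closed under meet and
  join. Injectivity of \<open>rmap\<close> is the consequence.\<close>

lemma rmap_subset_iff:
  assumes a: "a \<in> carrier A" and b: "b \<in> carrier A"
  shows "rmap A a \<subseteq> rmap A b \<longleftrightarrow> a \<preceq> b"
proof
  assume sub: "rmap A a \<subseteq> rmap A b"
  show "a \<preceq> b"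
  proof (rule ccontr)
    assume "\<not> a \<preceq> b"
    moreover have "a \<curlywedge> a = a" "b \<curlyvee> b = b"
      using a b le_refl by (auto simp: hle_def le_iff_join[symmetric])
    ultimately obtain g where "g \<in> prime_filters A" "{a} \<subseteq> g" "g \<inter> {b} = {}"
      using a b by (elim prime_filter_separation[of "{a}" "{b}", rotated -1]) auto
    with sub show False by (auto simp: rmap_def)
  qed
qed (use b prime_filter_le in \<open>auto simp: rmap_def\<close>)

lemma inj_on_rmap: "inj_on (rmap A) (carrier A)"
  by (rule inj_onI) (metis le_antisym order_refl rmap_subset_iff)

text \<open>A downset is the union of the principal downsets of its elements, and the principal downset
  of \<open>f\<close> is the intersection of the sets \<open>rmap A a\<close> for \<open>a \<in> f\<close>.\<close>

lemma rmap_surj: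
  assumes fin: "finite (carrier A)"
  shows "rmap A ` carrier A = downsets (\<F> A)"
proof
  show "rmap A ` carrier A \<subseteq> downsets (\<F> A)" using rmap_downset by blast
next
  let ?R = "rmap A ` carrier A"
  \<comment> \<open>The empty intersection is \<open>UNIV\<close>, which is never a value of
    \<open>rmap A\<close> because \<open>{}\<close> is not a prime filter; hence the condition
    \<open>X \<noteq> {}\<close>.\<close>
  have Int: "\<Inter>X \<in> ?R" if "finite X" "X \<noteq> {}" "X \<subseteq> ?R" for X
    using that
  proof (induction X rule: finite_ne_induct)
    case (insert x X)
    then obtain a b where "a \<in> carrier A" "b \<in> carrier A" "x = rmap A a" "\<Inter>X = rmap A b"
      by auto
    then have "\<Inter>(insert x X) = rmap A (a \<curlywedge> b)" "a \<curlywedge> b \<in> carrier A"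
      by (simp_all add: rmap_meet meet_closed)
    then show ?case by blast
  qed simp
  have Un: "\<Union>X \<in> ?R" if "finite X" "X \<subseteq> ?R" for X
    using that
  proof (induction X rule: finite_induct)
    case empty
    then show ?case using rmap_bot bot_closed by (metis Union_empty image_eqI)
  next
    case (insert x X)
    then obtain a b where "a \<in> carrier A" "b \<in> carrier A" "x = rmap A a" "\<Union>X = rmap A b"
      by auto
    then have "\<Union>(insert x X) = rmap A (a \<curlyvee> b)" "a \<curlyvee> b \<in> carrier A"
      by (simp_all add: rmap_join join_closed)
    then show ?case by blast
  qed
  show "downsets (\<F> A) \<subseteq> ?R"
  proof
    fix d assume d: "d \<in> downsets (\<F> A)"
    then have dp: "d \<subseteq> prime_filters A" by (simp add: downsets_def prime_forest_def)
    let ?D = "\<lambda>f. \<Inter>(rmap A ` f)"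
    have "?D f \<in> ?R" if "f \<in> d" for f
    proof (rule Int)
      have f: "f \<in> prime_filters A" using that dp by blast
      then have "f \<subseteq> carrier A" by (rule prime_filter_subset)
      then show "finite (rmap A ` f)" "rmap A ` f \<subseteq> ?R"
        using fin finite_subset by blast+
      show "rmap A ` f \<noteq> {}" using prime_filter_top[OF f] by blast
    qed
    then have sub: "?D ` d \<subseteq> ?R" by blast
    then have "\<Union>(?D ` d) \<in> ?R"
      using Un fin by (meson finite_imageI finite_subset)
    moreover have "\<Union>(?D ` d) = d"
    proof
      show "d \<subseteq> \<Union>(?D ` d)" using dp by (auto simp: rmap_def)
      show "\<Union>(?D ` d) \<subseteq> d"
      proof
        fix g assume "g \<in> \<Union>(?D ` d)"
        then obtain f where f: "f \<in> d" "\<forall>a\<in>f. g \<in> rmap A a" by auto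
        then have "f \<subseteq> g" by (auto simp: rmap_def)
        \<comment> \<open>Since \<open>f\<close> contains the top element, \<open>g\<close> lies in
          at least one \<open>rmap A a\<close>, and is therefore prime.\<close>
        moreover have "g \<in> prime_filters A"
          using f dp prime_filter_top by (fastforce simp: rmap_def)
        ultimately show "g \<in> d" using d f(1) by (auto simp: downsets_def prime_forest_def)
      qed
    qed
    ultimately show "d \<in> ?R" by simp
  qed
qed

lemma rmap_heyting_iso:
  assumes "finite (carrier A)"
  shows "rmap A \<in> heyting_iso A (\<G> (\<F> A))"
  using rmap_surj[OF assms]
  by (simp add: heyting_iso_def forest_algebra_def bij_betw_def inj_on_rmap rmap_meet rmap_join
      rmap_imp rmap_bot rmap_top) (simp add: prime_forest_def)

end

section \<open>The modal operators\<close>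

context gao
begin

lemma box_mono:
  assumes "a \<preceq> b" "a \<in> carrier A" "b \<in> carrier A"
  shows "box a \<preceq> box b"
  using assms box_meet unfolding hle_def by metis

lemma dia_mono:
  assumes "a \<preceq> b" "a \<in> carrier A" "b \<in> carrier A"
  shows "dia a \<preceq> dia b"
  using assms by (simp add: le_iff_join dia_closed flip: dia_join)

text \<open>Since \<open>h\<close> is onto, each operator law in \<open>B\<close> need only be
  checked at images, where it is the image of the law in \<open>A\<close>. The forest operators thus
  satisfy the laws without any computation with \<open>beta\<close> or \<open>delta\<close>.\<close>

lemma gao_transfer:
  assumes B: "godel_algebra B" and h: "h \<in> gao_iso (A, box, dia) (B, box', dia')"
  shows "gao B box' dia'"
proof -
  interpret B: godel_algebra B by (fact B)
  from h have surj: "h ` carrier A = carrier B"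
    and meet: "\<And>a b. \<lbrakk>a \<in> carrier A; b \<in> carrier A\<rbrakk> \<Longrightarrow> h a \<curlywedge>\<^bsub>B\<^esub> h b = h (a \<curlywedge> b)"
    and join: "\<And>a b. \<lbrakk>a \<in> carrier A; b \<in> carrier A\<rbrakk> \<Longrightarrow> h a \<curlyvee>\<^bsub>B\<^esub> h b = h (a \<curlyvee> b)"
    and bot: "\<^bold>\<bottom>\<^bsub>B\<^esub> = h \<^bold>\<bottom>" and top: "\<^bold>\<top>\<^bsub>B\<^esub> = h \<^bold>\<top>"
    and box': "\<And>a. a \<in> carrier A \<Longrightarrow> box' (h a) = h (box a)"
    and dia': "\<And>a. a \<in> carrier A \<Longrightarrow> dia' (h a) = h (dia a)"
    by (auto simp: heyting_iso_def bij_betw_def)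
  have closed: "h a \<in> carrier B" if "a \<in> carrier A" for a using that surj by blast
  show ?thesis
    by unfold_locales
      (auto simp: surj[symmetric] meet join bot top box' dia' box_closed dia_closed box_top dia_bot
        box_meet dia_join meet_closed join_closed bot_closed top_closed)
qed

end

section \<open>Common successors for both relations, from the Dunn axioms\<close>

context dunn_gao
begin

text \<open>Were some \<open>x\<close> in \<open>?P\<close> below \<open>a \<curlyvee> n\<close>,
  monotonicity and \<open>dunn_box\<close> would put \<open>box a \<curlyvee> dia n\<close> in the
  prime filter \<open>f\<close>, which contains neither joinand.\<close>

lemma R_both_box_witness:
  assumes f: "f \<in> prime_filters A" and a: "a \<in> carrier A" and nin: "box a \<notin> f"
  obtains g where "(f, g) \<in> R_both A box dia" "a \<notin> g"
proof -
  let ?P = "{b \<in> carrier A. box b \<in> f}"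
  let ?I = "{n \<in> carrier A. dia n \<notin> f}"
  let ?N = "(\<lambda>n. a \<curlyvee> n) ` ?I"
  have bot: "\<^bold>\<bottom> \<in> ?I" using bot_closed dia_bot prime_filter_bot[OF f] by simp
  obtain g where g: "g \<in> prime_filters A" "?P \<subseteq> g" "g \<inter> ?N = {}"
  proof (rule prime_filter_separation[of ?P ?N])
    show "?P \<noteq> {}" using top_closed box_top prime_filter_top[OF f] by auto
    show "x \<curlywedge> y \<in> ?P" if "x \<in> ?P" "y \<in> ?P" for x y
      using that f by (simp add: box_meet prime_filter_meet_iff meet_closed box_closed)
    show "?N \<subseteq> carrier A" using a join_closed by auto
    show "?N \<noteq> {}" using bot by blast
    show "x \<curlyvee> y \<in> ?N" if "x \<in> ?N" "y \<in> ?N" for x y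
    proof -
      from that obtain m n where mn: "m \<in> ?I" "n \<in> ?I" "x = a \<curlyvee> m" "y = a \<curlyvee> n" by blast
      then have "x \<curlyvee> y = a \<curlyvee> (m \<curlyvee> n)"
        using a by (simp add: join_join_distrib_left)
      moreover have "m \<curlyvee> n \<in> ?I"
        using mn f by (simp add: dia_join prime_filter_join_iff join_closed dia_closed)
      ultimately show ?thesis by blast
    qed
    show "\<not> x \<preceq> y" if "x \<in> ?P" "y \<in> ?N" for x y
    proof
      assume le: "x \<preceq> y"
      from that obtain n where n: "n \<in> ?I" "y = a \<curlyvee> n" and x: "x \<in> ?P" by blast
      then have "box x \<preceq> box (a \<curlyvee> n)" using le a join_closed box_mono by simp
      then have "box (a \<curlyvee> n) \<in> f"
        using f x n a by (auto intro: prime_filter_le simp: join_closed box_closed)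
      then have "box a \<curlyvee> dia n \<in> f"
        using f n a dunn_box by (auto intro: prime_filter_le simp: join_closed box_closed dia_closed)
      then show False using f n a nin by (auto simp: prime_filter_join_iff box_closed dia_closed)
    qed
  qed auto
  \<comment> \<open>A filter that omits \<open>a \<curlyvee> n\<close> omits \<open>n\<close>.
    Together with \<open>?P \<subseteq> g\<close> this gives the successor conditions for
    \<open>R_dia\<close> and \<open>R_box\<close>.\<close>
  have "n \<notin> g" if "n \<in> ?I" for n
    using g that a prime_filter_join_iff[OF g(1) a, of n] by blast
  moreover have "a \<notin> g" using g a bot prime_filter_join_iff[OF g(1) a bot_closed] by blast
  ultimately have "(f, g) \<in> R_both A box dia"
    using f g prime_filter_subset[OF g(1)] unfolding R_both_def R_box_def R_dia_def by blast
  with \<open>a \<notin> g\<close> show thesis using that by blast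
qed

text \<open>Dual to the previous lemma: \<open>b \<curlywedge> a \<preceq> n\<close> would give
  \<open>box b \<curlywedge> dia a \<preceq> dia n\<close> by \<open>dunn_dia\<close>, forcing
  \<open>dia n\<close> into \<open>f\<close>.\<close>

lemma R_both_dia_witness:
  assumes f: "f \<in> prime_filters A" and a: "a \<in> carrier A" and mem: "dia a \<in> f"
  obtains g where "(f, g) \<in> R_both A box dia" "a \<in> g"
proof -
  let ?Q = "{b \<in> carrier A. box b \<in> f}"
  let ?P = "(\<lambda>b. b \<curlywedge> a) ` ?Q"
  let ?N = "{n \<in> carrier A. dia n \<notin> f}"
  have top: "\<^bold>\<top> \<in> ?Q" using top_closed box_top prime_filter_top[OF f] by simp
  obtain g where g: "g \<in> prime_filters A" "?P \<subseteq> g" "g \<inter> ?N = {}"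
  proof (rule prime_filter_separation[of ?P ?N])
    show "?P \<subseteq> carrier A" using a meet_closed by auto
    show "?P \<noteq> {}" using top by blast
    show "x \<curlywedge> y \<in> ?P" if "x \<in> ?P" "y \<in> ?P" for x y
    proof -
      from that obtain m n where mn: "m \<in> ?Q" "n \<in> ?Q" "x = m \<curlywedge> a" "y = n \<curlywedge> a" by blast
      then have "x \<curlywedge> y = (m \<curlywedge> n) \<curlywedge> a"
        using a by (simp add: meet_meet_distrib_right)
      moreover have "m \<curlywedge> n \<in> ?Q"
        using mn f by (simp add: box_meet prime_filter_meet_iff meet_closed box_closed)
      ultimately show ?thesis by blast
    qed
    show "?N \<noteq> {}" using bot_closed dia_bot prime_filter_bot[OF f] by auto
    show "x \<curlyvee> y \<in> ?N" if "x \<in> ?N" "y \<in> ?N" for x y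
      using that f by (simp add: dia_join prime_filter_join_iff join_closed dia_closed)
    show "\<not> x \<preceq> y" if "x \<in> ?P" "y \<in> ?N" for x y
    proof
      assume le: "x \<preceq> y"
      from that obtain b where b: "b \<in> ?Q" "x = b \<curlywedge> a" and y: "y \<in> ?N" by blast
      have "box b \<curlywedge> dia a \<in> f"
        using f b a mem by (simp add: prime_filter_meet_iff box_closed dia_closed)
      moreover have "box b \<curlywedge> dia a \<preceq> dia (b \<curlywedge> a)"
        using b a dunn_dia[of b a] by (simp add: meet_comm)
      ultimately have "dia x \<in> f"
        using f b a by (auto intro: prime_filter_le simp: meet_closed dia_closed)
      moreover have "dia x \<preceq> dia y" using le a b y meet_closed dia_mono by simp
      ultimately show False using f y by (auto dest: prime_filter_le simp: dia_closed)
    qed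
  qed auto
  have mem: "b \<in> g \<and> a \<in> g" if "b \<in> ?Q" for b
    using g that a by (auto simp: prime_filter_meet_iff)
  then have "(f, g) \<in> R_both A box dia"
    using f g prime_filter_subset[OF g(1)] unfolding R_both_def R_box_def R_dia_def by blast
  with mem top show thesis using that by blast
qed

text \<open>Sandwiching \<open>S\<close> treats \<open>R_box\<close> and \<open>R_both\<close> at
  once. The upper bound gives the inclusion from left to right; the lower bound makes the witness
  for \<open>box a \<notin> f\<close> an \<open>S\<close>-successor.\<close>

lemma rmap_box:
  assumes a: "a \<in> carrier A" and S: "R_both A box dia \<subseteq> S" "S \<subseteq> R_box A box"
  shows "rmap A (box a) = beta A S (rmap A a)"
proof
  show "rmap A (box a) \<subseteq> beta A S (rmap A a)"
    using a S(2) by (auto simp: rmap_def beta_def R_box_def)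
  show "beta A S (rmap A a) \<subseteq> rmap A (box a)"
  proof
    fix f assume f: "f \<in> beta A S (rmap A a)"
    then have fp: "f \<in> prime_filters A" by (simp add: beta_def)
    have "box a \<in> f"
    proof (rule ccontr)
      assume "box a \<notin> f"
      then obtain g where "(f, g) \<in> R_both A box dia" "a \<notin> g"
        using R_both_box_witness fp a by blast
      then show False using f S by (auto simp: beta_def rmap_def R_box_def)
    qed
    then show "f \<in> rmap A (box a)" using fp by (simp add: rmap_def)
  qed
qed

text \<open>Same sandwich: the upper bound turns a successor containing \<open>a\<close> into
  \<open>dia a \<in> f\<close>, and the lower bound admits the witness for the converse.\<close>

lemma rmap_dia:
  assumes a: "a \<in> carrier A" and S: "R_both A box dia \<subseteq> S" "S \<subseteq> R_dia A dia"
  shows "rmap A (dia a) = delta A S (rmap A a)"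
proof
  show "delta A S (rmap A a) \<subseteq> rmap A (dia a)"
    using a S(2) by (auto simp: rmap_def delta_def R_dia_def)
  show "rmap A (dia a) \<subseteq> delta A S (rmap A a)"
  proof
    fix f assume "f \<in> rmap A (dia a)"
    then have fp: "f \<in> prime_filters A" "dia a \<in> f" by (simp_all add: rmap_def)
    then obtain g where "(f, g) \<in> R_both A box dia" "a \<in> g"
      using R_both_dia_witness a by blast
    then show "f \<in> delta A S (rmap A a)"
      using fp S by (auto simp: delta_def rmap_def R_dia_def)
  qed
qed

end

theorem theorem5p4:
  fixes A :: "'a heyting" and box dia :: "'a \<Rightarrow> 'a"
  assumes "dunn_gao A box dia" and "finite (carrier A)"
  shows
    "gao (\<G> (\<F> A)) (beta A (R_box A box)) (delta A (R_dia A dia)) \<and>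
    gao (\<G> (\<F> A)) (beta A (R_both A box dia)) (delta A (R_both A box dia)) \<and>
    rmap A \<in> gao_iso (A, box, dia)
           (\<G> (\<F> A), beta A (R_box A box), delta A (R_dia A dia)) \<and>
    rmap A \<in> gao_iso (A, box, dia)
           (\<G> (\<F> A), beta A (R_both A box dia), delta A (R_both A box dia)) \<and>
    (\<G> (\<F> A), beta A (R_box A box), delta A (R_dia A dia)) \<cong>\<^sub>G
         (\<G> (\<F> A), beta A (R_both A box dia), delta A (R_both A box dia)) \<and>
    (\<forall>a\<in>carrier A.
           rmap A (box a) = beta A (R_box A box) (rmap A a) \<and>
           beta A (R_box A box) (rmap A a) = beta A (R_both A box dia) (rmap A a) \<and>
           rmap A (dia a) = delta A (R_dia A dia) (rmap A a) \<and>
           delta A (R_dia A dia) (rmap A a) = delta A (R_both A box dia) (rmap A a))"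
proof -
  interpret dunn_gao A box dia by (fact assms(1))
  let ?B = "\<G> (\<F> A)"
  let ?R = "R_both A box dia"
  let ?X = "(?B, beta A (R_box A box), delta A (R_dia A dia))"
  let ?Y = "(?B, beta A ?R, delta A ?R)"
  have B: "godel_algebra ?B"
    using finite_forest.godel_algebra_forest_algebra finite_forest_prime_forest assms(2) by blast
  have sub: "?R \<subseteq> R_box A box" "?R \<subseteq> R_dia A dia" by (auto simp: R_both_def)
  have box1: "rmap A (box a) = beta A (R_box A box) (rmap A a)"
    and box2: "rmap A (box a) = beta A ?R (rmap A a)"
    and dia1: "rmap A (dia a) = delta A (R_dia A dia) (rmap A a)"
    and dia2: "rmap A (dia a) = delta A ?R (rmap A a)" if "a \<in> carrier A" for a
    by (rule rmap_box rmap_dia; use that sub in simp)+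
  have iso1: "rmap A \<in> gao_iso (A, box, dia) ?X" and iso2: "rmap A \<in> gao_iso (A, box, dia) ?Y"
    using rmap_heyting_iso[OF assms(2)] box1 box2 dia1 dia2 by auto
  \<comment> \<open>Every downset is some \<open>rmap A a\<close>, so the two pairs of operators
    agree on the whole carrier and the identity is an isomorphism between the two forest
    algebras.\<close>
  have "carrier ?B = rmap A ` carrier A"
    using rmap_surj[OF assms(2)] by (simp add: forest_algebra_def)
  then have "id \<in> gao_iso ?X ?Y"
    using box1 box2 dia1 dia2 by (auto simp: heyting_iso_def)
  then have "?X \<cong>\<^sub>G ?Y" unfolding gao_isomorphic_def by blast
  then show ?thesis
    using gao_transfer[OF B iso1] gao_transfer[OF B iso2] iso1 iso2
    by (intro conjI ballI) (assumption | metis box1 box2 dia1 dia2)+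
qed

end
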